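(* Let $V=\mathbb R^n$, let $\mathfrak g$ be a Lie subalgebra of $\mathrm{End}\,V$, and let $r\in\bigwedge^2\mathfrak g\subset\mathrm{End}\,V\otimes\mathrm{End}\,V$ be a classical $r$-matrix, $r=\sum r^{jk}_{lm}\,e_j{}^l\otimes e_k{}^m$, such that the brackets $$\{x^j,x^k\}=\sum_{l,m}r^{jk}_{lm}x^lx^m\ \text{ on } V,\qquad \{p_l,p_m\}=\sum_{j,k}p_jp_k\,r^{jk}_{lm}\ \text{ on } V^*$$ satisfy the Jacobi identity. Suppose $(\mathfrak g,r)$ is quasitriangular, i.e. there exists a $\mathfrak g$-invariant symmetric element $s\in\mathfrak g\otimes\mathfrak g$ such that $w:=r+s$ satisfies the classical Yang–Baxter equation $$[[w,w]]:=[w_{12},w_{13}]+[w_{12},w_{23}]+[w_{13},w_{23}]=0.$$ Then the brackets on $T^*V=V\times V^*$ defined by $$\{x^j,x^k\}=\sum_{l,m}r^{jk}_{lm}x^lx^m,\qquad \{p_l,p_m\}=\sum_{j,k}p_jp_k\,r^{jk}_{lm},\qquad \{p_l,x^k\}=-\sum_{j,m}p_j\,w^{jk}_{lm}\,x^m$$ satisfy the Jacobi identity.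
   Context: $e_j{}^l$ are the matrix units in $\mathrm{End}\,V$ ($e_j{}^l x=x^le_j$), and components of an element $\rho\in\mathrm{End}\,V\otimes\mathrm{End}\,V$ are given by $\rho=\sum\rho^{jk}_{lm}e_j{}^l\otimes e_k{}^m$. $x^j$ are the coordinates on $V$ and $p_j$ the dual coordinates on $V^*$. $\rho_{12},\rho_{13},\rho_{23}$ denote $\rho$ placed in the indicated factors of $(\mathrm{End}\,V)^{\otimes3}$. A classical $r$-matrix on $\mathfrak g$ is an $r\in\bigwedge^2\mathfrak g$ whose Schouten bracket $[r,r]\in\bigwedge^3\mathfrak g$ is $\mathfrak g$-invariant. Brackets of coordinates are extended to all smooth functions as a skew-symmetric biderivation. *)

theory Defs
  imports "HOL-Analysis.Analysis"
begin

section \<open>Tensor powers of \<open>End V\<close> for \<open>V = real ^ 'n\<close>\<close>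

text \<open>
  An endomorphism of \<open>V\<close> is its matrix \<open>A = (\<Sum>j l. A $ j $ l *\<^sub>R e_j^l)\<close>.  The algebra
  \<open>End V \<otimes> End V\<close> is identified with \<open>End (V \<otimes> V)\<close>, that is with the matrices indexed by
  \<open>'n \<times> 'n\<close>, and \<open>End V \<otimes> End V \<otimes> End V\<close> with the matrices indexed by \<open>'n \<times> 'n \<times> 'n\<close>;
  multiplication is then \<open>**\<close>.  The component $\rho^{jk}_{lm}$ is \<open>\<rho> $ (j, k) $ (l, m)\<close>
  (see \<open>matrix_unit_expansion\<close> below).
\<close>

type_synonym 'n mat1 = "real ^ 'n ^ 'n"
type_synonym 'n mat2 = "real ^ ('n \<times> 'n) ^ ('n \<times> 'n)"
type_synonym 'n mat3 = "real ^ ('n \<times> 'n \<times> 'n) ^ ('n \<times> 'n \<times> 'n)"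

definition matrix_unit :: "'n::finite \<Rightarrow> 'n \<Rightarrow> 'n mat1" where
  "matrix_unit j l = (\<chi> a b. if a = j \<and> b = l then 1 else 0)"

definition tensor :: "'a::finite mat1 \<Rightarrow> 'b::finite mat1 \<Rightarrow> ('a \<times> 'b) mat1" (infixr "\<otimes>\<^sub>M" 72) where
  "A \<otimes>\<^sub>M B = (\<chi> i j. A $ fst i $ fst j * B $ snd i $ snd j)"

definition commutator :: "'n::finite mat1 \<Rightarrow> 'n mat1 \<Rightarrow> 'n mat1" where
  "commutator A B = A ** B - B ** A"

definition lie_subalgebra :: "('n::finite mat1) set \<Rightarrow> bool" where
  "lie_subalgebra \<g> \<longleftrightarrow> subspace \<g> \<and> (\<forall>A\<in>\<g>. \<forall>B\<in>\<g>. commutator A B \<in> \<g>)"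

definition tensor_square :: "('n::finite mat1) set \<Rightarrow> ('n mat2) set" where
  "tensor_square \<g> = span {A \<otimes>\<^sub>M B |A B. A \<in> \<g> \<and> B \<in> \<g>}"

definition wedge2 :: "'n::finite mat1 \<Rightarrow> 'n mat1 \<Rightarrow> 'n mat2" where
  "wedge2 A B = A \<otimes>\<^sub>M B - B \<otimes>\<^sub>M A"

definition exterior_square :: "('n::finite mat1) set \<Rightarrow> ('n mat2) set" where
  "exterior_square \<g> = span {wedge2 A B |A B. A \<in> \<g> \<and> B \<in> \<g>}"

definition wedge3 :: "'n::finite mat1 \<Rightarrow> 'n mat1 \<Rightarrow> 'n mat1 \<Rightarrow> 'n mat3" where
  "wedge3 A B C =
     A \<otimes>\<^sub>M B \<otimes>\<^sub>M C + B \<otimes>\<^sub>M C \<otimes>\<^sub>M A + C \<otimes>\<^sub>M A \<otimes>\<^sub>M B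
     - B \<otimes>\<^sub>M A \<otimes>\<^sub>M C - A \<otimes>\<^sub>M C \<otimes>\<^sub>M B - C \<otimes>\<^sub>M B \<otimes>\<^sub>M A"

definition flip :: "'n::finite mat2 \<Rightarrow> 'n mat2" where
  "flip \<rho> = (\<chi> i j. \<rho> $ (snd i, fst i) $ (snd j, fst j))"

text \<open>The adjoint action of \<open>X\<close> on a tensor power is commutation with the coproduct of \<open>X\<close>.\<close>

definition invariant2 :: "('n::finite mat1) set \<Rightarrow> 'n mat2 \<Rightarrow> bool" where
  "invariant2 \<g> s \<longleftrightarrow>
     (\<forall>X\<in>\<g>. commutator (X \<otimes>\<^sub>M mat 1 + mat 1 \<otimes>\<^sub>M X) s = 0)"

definition invariant3 :: "('n::finite mat1) set \<Rightarrow> 'n mat3 \<Rightarrow> bool" where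
  "invariant3 \<g> T \<longleftrightarrow>
     (\<forall>X\<in>\<g>. commutator
        (X \<otimes>\<^sub>M mat 1 \<otimes>\<^sub>M mat 1 + mat 1 \<otimes>\<^sub>M X \<otimes>\<^sub>M mat 1 + mat 1 \<otimes>\<^sub>M mat 1 \<otimes>\<^sub>M X) T = 0)"

definition leg12 :: "'n::finite mat2 \<Rightarrow> 'n mat3" where
  "leg12 \<rho> = (\<chi> i j. case (i, j) of ((a, b, c), (a', b', c')) \<Rightarrow>
     \<rho> $ (a, b) $ (a', b') * (if c = c' then 1 else 0))"

definition leg13 :: "'n::finite mat2 \<Rightarrow> 'n mat3" where
  "leg13 \<rho> = (\<chi> i j. case (i, j) of ((a, b, c), (a', b', c')) \<Rightarrow>
     \<rho> $ (a, c) $ (a', c') * (if b = b' then 1 else 0))"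

definition leg23 :: "'n::finite mat2 \<Rightarrow> 'n mat3" where
  "leg23 \<rho> = (\<chi> i j. case (i, j) of ((a, b, c), (a', b', c')) \<Rightarrow>
     \<rho> $ (b, c) $ (b', c') * (if a = a' then 1 else 0))"

definition cyb :: "'n::finite mat2 \<Rightarrow> 'n mat3" where
  "cyb w = commutator (leg12 w) (leg13 w) + commutator (leg12 w) (leg23 w)
     + commutator (leg13 w) (leg23 w)"

text \<open>
  The algebraic Schouten bracket of bivectors, by bilinearity from matrix units.  The defining
  rule on decomposable bivectors is \<open>schouten_wedge2\<close> below.
\<close>

definition schouten :: "'n::finite mat2 \<Rightarrow> 'n mat2 \<Rightarrow> 'n mat3" where
  "schouten \<rho> \<sigma> =
     (\<Sum>j\<in>UNIV. \<Sum>l\<in>UNIV. \<Sum>k\<in>UNIV. \<Sum>m\<in>UNIV. \<Sum>j'\<in>UNIV. \<Sum>l'\<in>UNIV. \<Sum>k'\<in>UNIV. \<Sum>m'\<in>UNIV.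
        (\<rho> $ (j, k) $ (l, m) * \<sigma> $ (j', k') $ (l', m')) *\<^sub>R
        wedge3 (commutator (matrix_unit j l) (matrix_unit j' l'))
          (matrix_unit k m) (matrix_unit k' m'))"

definition classical_r_matrix :: "('n::finite mat1) set \<Rightarrow> 'n mat2 \<Rightarrow> bool" where
  "classical_r_matrix \<g> r \<longleftrightarrow> r \<in> exterior_square \<g> \<and> invariant3 \<g> (schouten r r)"


subsection \<open>Consistency of the encoding\<close>

lemma matrix_unit_apply: "matrix_unit j l *v x = x $ l *\<^sub>R axis j 1"
proof -
  have "(\<Sum>b\<in>UNIV. (if a = j \<and> b = l then 1 else 0) * x $ b) = (if a = j then x $ l else 0)" for a
  proof -
    have "(if a = j \<and> b = l then 1 else 0) * x $ b = (if b = l then if a = j then x $ b else 0 else 0)"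
      for b by simp
    then show ?thesis by simp
  qed
  then show ?thesis
    by (simp add: vec_eq_iff matrix_vector_mult_def matrix_unit_def axis_def)
qed

lemma matrix_unit_sum:
  fixes A :: "'n::finite mat1"
  shows "A = (\<Sum>j\<in>UNIV. \<Sum>l\<in>UNIV. A $ j $ l *\<^sub>R matrix_unit j l)"
proof -
  have "c * (if a = j \<and> b = l then 1 else 0) = (if b = l then if a = j then c else 0 else 0)"
    for a b j l :: 'n and c :: real by simp
  then show ?thesis
    by (simp add: vec_eq_iff matrix_unit_def)
qed

lemma matrix_unit_expansion:
  fixes \<rho> :: "'n::finite mat2"
  shows "\<rho> = (\<Sum>j\<in>UNIV. \<Sum>k\<in>UNIV. \<Sum>l\<in>UNIV. \<Sum>m\<in>UNIV.
           \<rho> $ (j, k) $ (l, m) *\<^sub>R (matrix_unit j l \<otimes>\<^sub>M matrix_unit k m))"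
proof -
  have *: "c * ((if a = j \<and> b = l then 1 else 0) * (if a' = k \<and> b' = m then 1 else 0))
      = (if b' = m then if b = l then if a' = k then if a = j then c else 0 else 0 else 0 else 0)"
    for a b j l a' b' k m and c :: real by simp
  show ?thesis
    by (simp add: vec_eq_iff matrix_unit_def tensor_def * sum.delta)
qed

lemma tensor_mult:
  "(A \<otimes>\<^sub>M B) ** (C \<otimes>\<^sub>M D) = (A ** C) \<otimes>\<^sub>M (B ** D)"
  by (auto simp: vec_eq_iff tensor_def matrix_matrix_mult_def sum_product sum.cartesian_product
      simp flip: UNIV_Times_UNIV intro!: sum.cong)

lemma
  shows leg12_tensor: "leg12 (A \<otimes>\<^sub>M B) = A \<otimes>\<^sub>M B \<otimes>\<^sub>M mat 1"
    and leg13_tensor: "leg13 (A \<otimes>\<^sub>M B) = A \<otimes>\<^sub>M mat 1 \<otimes>\<^sub>M B"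
    and leg23_tensor: "leg23 (A \<otimes>\<^sub>M B) = mat 1 \<otimes>\<^sub>M A \<otimes>\<^sub>M B"
  by (simp_all add: vec_eq_iff leg12_def leg13_def leg23_def tensor_def mat_def)

lemma linear_matrix_unit_sum:
  assumes "linear f"
  shows "f A = (\<Sum>j\<in>UNIV. \<Sum>l\<in>UNIV. A $ j $ l *\<^sub>R f (matrix_unit j l))"
proof -
  have "f A = f (\<Sum>j\<in>UNIV. \<Sum>l\<in>UNIV. A $ j $ l *\<^sub>R matrix_unit j l)"
    using matrix_unit_sum[of A] by simp
  then show ?thesis
    by (simp add: linear_sum[OF assms] linear_cmul[OF assms])
qed

lemma schouten_bilinear: "bilinear schouten"
  unfolding bilinear_def
  by (auto intro!: linearI
      simp: schouten_def sum.distrib scaleR_add_left algebra_simps scaleR_sum_right)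

lemma linear_tensor: "linear (\<lambda>A. A \<otimes>\<^sub>M B)" "linear (\<lambda>B. A \<otimes>\<^sub>M B)"
  by (auto intro!: linearI simp: vec_eq_iff tensor_def algebra_simps)

lemma linear_commutator: "linear (\<lambda>A. commutator A B)"
  "linear (\<lambda>B. commutator A B)"
  by (auto intro!: linearI simp: vec_eq_iff commutator_def matrix_matrix_mult_def
      algebra_simps sum.distrib sum_distrib_left)

lemma linear_wedge3: "linear (\<lambda>A. wedge3 A B C)" "linear (\<lambda>B. wedge3 A B C)"
  "linear (\<lambda>C. wedge3 A B C)"
  by (auto intro!: linearI simp: vec_eq_iff wedge3_def tensor_def algebra_simps)

lemma schouten_tensor:
  "schouten (A \<otimes>\<^sub>M B) (C \<otimes>\<^sub>M D) = wedge3 (commutator A C) B D"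
proof -
  have eA: "wedge3 (commutator A C) B D =
      (\<Sum>j\<in>UNIV. \<Sum>l\<in>UNIV. A $ j $ l *\<^sub>R wedge3 (commutator (matrix_unit j l) C) B D)"
    using linear_matrix_unit_sum[OF linear_compose[OF linear_commutator(1) linear_wedge3(1)]]
    by (simp add: o_def)
  have eC: "wedge3 (commutator X C) Y D =
      (\<Sum>j\<in>UNIV. \<Sum>l\<in>UNIV. C $ j $ l *\<^sub>R wedge3 (commutator X (matrix_unit j l)) Y D)" for X Y
    using linear_matrix_unit_sum[OF linear_compose[OF linear_commutator(2) linear_wedge3(1)]]
    by (simp add: o_def)
  have eB: "wedge3 X B Y = (\<Sum>k\<in>UNIV. \<Sum>m\<in>UNIV. B $ k $ m *\<^sub>R wedge3 X (matrix_unit k m) Y)"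
    for X Y
    by (rule linear_matrix_unit_sum[OF linear_wedge3(2)])
  have eD: "wedge3 X Y D = (\<Sum>k\<in>UNIV. \<Sum>m\<in>UNIV. D $ k $ m *\<^sub>R wedge3 X Y (matrix_unit k m))"
    for X Y
    by (rule linear_matrix_unit_sum[OF linear_wedge3(3)])
  show ?thesis
    unfolding eA unfolding eB unfolding eC unfolding eD
    by (simp add: schouten_def tensor_def scaleR_sum_right mult_ac)
qed

lemma schouten_wedge2:
  "schouten (wedge2 A B) (wedge2 C D) =
     wedge3 (commutator A C) B D - wedge3 (commutator A D) B C
     - wedge3 (commutator B C) A D + wedge3 (commutator B D) A C"
  by (simp add: wedge2_def bilinear_lsub[OF schouten_bilinear] bilinear_rsub[OF schouten_bilinear]
      schouten_tensor)


section \<open>Smooth functions and brackets\<close>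

primrec Ck :: "nat \<Rightarrow> ('a::real_normed_vector \<Rightarrow> real) \<Rightarrow> bool" where
  "Ck 0 f \<longleftrightarrow> continuous_on UNIV f"
| "Ck (Suc k) f \<longleftrightarrow> (\<forall>x. f differentiable at x) \<and> (\<forall>v. Ck k (\<lambda>x. frechet_derivative f (at x) v))"

definition smooth :: "('a::real_normed_vector \<Rightarrow> real) \<Rightarrow> bool" where
  "smooth f \<longleftrightarrow> (\<forall>k. Ck k f)"

text \<open>
  A \<open>frame\<close> \<open>e\<close> numbers the standard basis of the space by an index type; the associated
  coordinate functions are \<open>coord e i\<close>.
\<close>

definition frame :: "('i::finite \<Rightarrow> 'a::euclidean_space) \<Rightarrow> bool" where
  "frame e \<longleftrightarrow> bij_betw e UNIV Basis"

definition coord :: "('i::finite \<Rightarrow> 'a::euclidean_space) \<Rightarrow> 'i \<Rightarrow> 'a \<Rightarrow> real" where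
  "coord e i = (\<lambda>z. z \<bullet> e i)"

definition skew_biderivation ::
  "(('a::euclidean_space \<Rightarrow> real) \<Rightarrow> ('a \<Rightarrow> real) \<Rightarrow> 'a \<Rightarrow> real) \<Rightarrow> bool" where
  "skew_biderivation B \<longleftrightarrow>
     (\<forall>f g. smooth f \<longrightarrow> smooth g \<longrightarrow>
        smooth (B f g) \<and> B f g = (\<lambda>z. - B g f z)) \<and>
     (\<forall>f f' g. smooth f \<longrightarrow> smooth f' \<longrightarrow> smooth g \<longrightarrow>
        B (\<lambda>z. f z + f' z) g = (\<lambda>z. B f g z + B f' g z) \<and>
        (\<forall>c. B (\<lambda>z. c * f z) g = (\<lambda>z. c * B f g z)) \<and>
        B (\<lambda>z. f z * f' z) g = (\<lambda>z. f z * B f' g z + B f g z * f' z))"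

text \<open>
  The extension to all functions of the coordinate brackets \<open>{z_i, z_j} = \<pi> i j\<close>.  For a skew
  family of smooth functions \<open>\<pi>\<close> this is the unique skew-symmetric biderivation of smooth functions
  with these values: see \<open>skew_biderivation_bracket\<close>, \<open>bracket_coord\<close> and \<open>bracket_unique\<close>.
\<close>

definition bracket :: "('i::finite \<Rightarrow> 'a::euclidean_space) \<Rightarrow> ('i \<Rightarrow> 'i \<Rightarrow> 'a \<Rightarrow> real) \<Rightarrow>
    ('a \<Rightarrow> real) \<Rightarrow> ('a \<Rightarrow> real) \<Rightarrow> 'a \<Rightarrow> real" where
  "bracket e \<pi> f g = (\<lambda>z. \<Sum>i\<in>UNIV. \<Sum>j\<in>UNIV.
     \<pi> i j z * frechet_derivative f (at z) (e i) * frechet_derivative g (at z) (e j))"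

definition jacobi_identity ::
  "(('a::euclidean_space \<Rightarrow> real) \<Rightarrow> ('a \<Rightarrow> real) \<Rightarrow> 'a \<Rightarrow> real) \<Rightarrow> bool" where
  "jacobi_identity B \<longleftrightarrow> (\<forall>f g h. smooth f \<longrightarrow> smooth g \<longrightarrow> smooth h \<longrightarrow>
     (\<forall>z. B f (B g h) z + B g (B h f) z + B h (B f g) z = 0))"


subsection \<open>The coordinate brackets on \<open>V\<close>, \<open>V\<^sup>*\<close> and \<open>T\<^sup>*V = V \<times> V\<^sup>*\<close>\<close>

text \<open>
  \<open>V\<^sup>*\<close> is \<open>real ^ 'n\<close> through the dual basis, so that \<open>p_j\<close> is \<open>p $ j\<close>.  On \<open>T\<^sup>*V\<close> the index
  \<open>Inl j\<close> belongs to \<open>x^j\<close> and \<open>Inr j\<close> to \<open>p_j\<close>.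
\<close>

definition vec_frame :: "'n::finite \<Rightarrow> real ^ 'n" where
  "vec_frame j = axis j 1"

definition cotangent_frame :: "'n::finite + 'n \<Rightarrow> (real ^ 'n) \<times> (real ^ 'n)" where
  "cotangent_frame i = (case i of Inl j \<Rightarrow> (axis j 1, 0) | Inr j \<Rightarrow> (0, axis j 1))"

definition xx_bracket :: "'n::finite mat2 \<Rightarrow> 'n \<Rightarrow> 'n \<Rightarrow> real ^ 'n \<Rightarrow> real" where
  "xx_bracket r j k = (\<lambda>x. \<Sum>l\<in>UNIV. \<Sum>m\<in>UNIV. r $ (j, k) $ (l, m) * x $ l * x $ m)"

definition pp_bracket :: "'n::finite mat2 \<Rightarrow> 'n \<Rightarrow> 'n \<Rightarrow> real ^ 'n \<Rightarrow> real" where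
  "pp_bracket r l m = (\<lambda>p. \<Sum>j\<in>UNIV. \<Sum>k\<in>UNIV. p $ j * p $ k * r $ (j, k) $ (l, m))"

definition px_bracket :: "'n::finite mat2 \<Rightarrow> 'n \<Rightarrow> 'n \<Rightarrow> (real ^ 'n) \<times> (real ^ 'n) \<Rightarrow> real" where
  "px_bracket w l k = (\<lambda>(x, p). - (\<Sum>j\<in>UNIV. \<Sum>m\<in>UNIV. p $ j * w $ (j, k) $ (l, m) * x $ m))"

fun cotangent_bracket :: "'n::finite mat2 \<Rightarrow> 'n mat2 \<Rightarrow> 'n + 'n \<Rightarrow> 'n + 'n \<Rightarrow>
    (real ^ 'n) \<times> (real ^ 'n) \<Rightarrow> real" where
  "cotangent_bracket r w (Inl j) (Inl k) (x, p) = xx_bracket r j k x"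
| "cotangent_bracket r w (Inr l) (Inr m) (x, p) = pp_bracket r l m p"
| "cotangent_bracket r w (Inr l) (Inl k) (x, p) = px_bracket w l k (x, p)"
| "cotangent_bracket r w (Inl k) (Inr l) (x, p) = - px_bracket w l k (x, p)"


subsection \<open>\<open>bracket\<close> is the skew-symmetric biderivation extending the coordinate brackets\<close>

lemma Ck_SucI:
  assumes "\<And>x. (f has_derivative f' x) (at x)" "\<And>v. Ck k (\<lambda>x. f' x v)"
  shows "Ck (Suc k) f"
proof -
  have "frechet_derivative f (at x) = f' x" for x
    using frechet_derivative_at[OF assms(1)] by simp
  then show ?thesis
    using assms by (auto simp: differentiable_def)
qed

lemma Ck_SucD:
  assumes "Ck (Suc k) f"
  shows "(f has_derivative frechet_derivative f (at x)) (at x)"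
    "Ck k (\<lambda>x. frechet_derivative f (at x) v)"
  using assms by (auto simp: frechet_derivative_works)

lemma Ck_continuous: "Ck k f \<Longrightarrow> continuous_on UNIV f"
  by (cases k) (auto simp: continuous_on_eq_continuous_at differentiable_imp_continuous_within)

lemma Ck_Suc_imp: "Ck (Suc k) f \<Longrightarrow> Ck k f"
proof (induction k arbitrary: f)
  case 0
  then show ?case using Ck_continuous[of "Suc 0" f] by simp
next
  case (Suc k)
  show ?case
    by (rule Ck_SucI[OF Ck_SucD(1)[OF Suc.prems]])
      (rule Suc.IH, rule Ck_SucD(2)[OF Suc.prems])
qed

lemma Ck_const: "Ck k (\<lambda>x. c)"
  by (induction k arbitrary: c) auto

lemma Ck_add: "Ck k f \<Longrightarrow> Ck k g \<Longrightarrow> Ck k (\<lambda>x. f x + g x)"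
proof (induction k arbitrary: f g)
  case 0
  then show ?case by (auto intro: continuous_on_add)
next
  case (Suc k)
  show ?case
    by (rule Ck_SucI[OF has_derivative_add[OF Ck_SucD(1)[OF Suc.prems(1)] Ck_SucD(1)[OF Suc.prems(2)]]])
      (intro Suc.IH Ck_SucD Suc.prems)
qed

lemma Ck_mult: "Ck k f \<Longrightarrow> Ck k g \<Longrightarrow> Ck k (\<lambda>x. f x * g x)"
proof (induction k arbitrary: f g)
  case 0
  then show ?case by (auto intro: continuous_on_mult)
next
  case (Suc k)
  show ?case
    by (rule Ck_SucI[OF has_derivative_mult[OF Ck_SucD(1)[OF Suc.prems(1)] Ck_SucD(1)[OF Suc.prems(2)]]])
      (intro Ck_add Suc.IH Ck_SucD(2) Suc.prems Suc.prems[THEN Ck_Suc_imp])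
qed

lemma Ck_bounded_linear: "bounded_linear f \<Longrightarrow> Ck k f"
proof (cases k)
  case 0
  assume "bounded_linear f"
  then show ?thesis using 0 by (simp add: linear_continuous_on)
next
  case (Suc k)
  assume f: "bounded_linear f"
  show ?thesis
    unfolding Suc by (rule Ck_SucI[OF bounded_linear_imp_has_derivative[OF f] Ck_const])
qed

lemma smooth_const: "smooth (\<lambda>x. c)"
  by (simp add: smooth_def Ck_const)

lemma smooth_add: "smooth f \<Longrightarrow> smooth g \<Longrightarrow> smooth (\<lambda>x. f x + g x)"
  by (simp add: smooth_def Ck_add)

lemma smooth_mult: "smooth f \<Longrightarrow> smooth g \<Longrightarrow> smooth (\<lambda>x. f x * g x)"
  by (simp add: smooth_def Ck_mult)

lemma smooth_sum: "(\<And>i. i \<in> I \<Longrightarrow> smooth (f i)) \<Longrightarrow> smooth (\<lambda>x. \<Sum>i\<in>I. f i x)"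
  by (induction I rule: infinite_finite_induct) (auto intro: smooth_const smooth_add)

lemma smooth_bounded_linear: "bounded_linear f \<Longrightarrow> smooth f"
  by (simp add: smooth_def Ck_bounded_linear)

lemma smooth_coord: "smooth (coord e i)"
  unfolding coord_def by (intro smooth_bounded_linear bounded_linear_inner_left)

lemma smooth_has_derivative:
  "smooth f \<Longrightarrow> (f has_derivative frechet_derivative f (at x)) (at x)"
  using Ck_SucD(1) unfolding smooth_def by blast

lemma smooth_frechet_derivative:
  "smooth f \<Longrightarrow> smooth (\<lambda>x. frechet_derivative f (at x) v)"
  using Ck_SucD(2) unfolding smooth_def by blast

lemma frechet_derivative_add:
  "smooth f \<Longrightarrow> smooth g \<Longrightarrow> frechet_derivative (\<lambda>x. f x + g x) (at x) =
     (\<lambda>v. frechet_derivative f (at x) v + frechet_derivative g (at x) v)"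
  by (rule frechet_derivative_at[symmetric]) (intro has_derivative_add smooth_has_derivative)

lemma frechet_derivative_mult:
  "smooth f \<Longrightarrow> smooth g \<Longrightarrow> frechet_derivative (\<lambda>x. f x * g x) (at x) =
     (\<lambda>v. f x * frechet_derivative g (at x) v + frechet_derivative f (at x) v * g x)"
  by (rule frechet_derivative_at[symmetric]) (intro has_derivative_mult smooth_has_derivative)

lemma frechet_derivative_coord: "frechet_derivative (coord e i) (at x) = coord e i"
  unfolding coord_def
  by (rule frechet_derivative_at[symmetric])
    (intro bounded_linear_imp_has_derivative bounded_linear_inner_left)

lemma coord_frame:
  assumes "frame e"
  shows "coord e i (e j) = (if i = j then 1 else 0)"
proof -
  have "e i \<in> Basis" "e j \<in> Basis" "e j = e i \<longleftrightarrow> i = j"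
    using assms unfolding frame_def bij_betw_def inj_on_def by auto
  then show ?thesis
    by (simp add: coord_def inner_Basis)
qed

lemma frame_vec_frame: "frame (vec_frame :: 'n::finite \<Rightarrow> _)"
  unfolding frame_def vec_frame_def bij_betw_def inj_on_def Basis_vec_def
  by (auto simp: axis_eq_axis)

lemma frame_cotangent_frame: "frame (cotangent_frame :: 'n::finite + 'n \<Rightarrow> _)"
proof -
  have "inj (cotangent_frame :: 'n + 'n \<Rightarrow> _)"
    by (auto simp: inj_on_def cotangent_frame_def axis_eq_axis split: sum.splits)
  moreover have "range (cotangent_frame :: 'n + 'n \<Rightarrow> _)
      = range (\<lambda>j. (axis j 1, 0)) \<union> range (\<lambda>j. (0, axis j 1))"
    unfolding UNIV_sum image_Un image_image cotangent_frame_def by simp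
  then have "range (cotangent_frame :: 'n + 'n \<Rightarrow> _) = Basis"
    by (auto simp: Basis_prod_def Basis_vec_def)
  ultimately show ?thesis
    by (simp add: frame_def bij_betw_def)
qed

lemma coord_vec_frame: "coord vec_frame j x = x $ j"
  by (simp add: coord_def vec_frame_def inner_axis)

lemma coord_cotangent_frame:
  "coord cotangent_frame (Inl j) (x, p) = x $ j" "coord cotangent_frame (Inr j) (x, p) = p $ j"
  by (simp_all add: coord_def cotangent_frame_def inner_axis)

lemma bracket_coord:
  assumes "frame e"
  shows "bracket e \<pi> (coord e i) (coord e j) = \<pi> i j"
  by (simp add: bracket_def frechet_derivative_coord coord_frame[OF assms] sum.delta mult_delta_right)

lemma skew_biderivation_bracket:
  fixes e :: "'i::finite \<Rightarrow> 'a::euclidean_space"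
  assumes "\<And>i j. smooth (\<pi> i j)" "\<And>i j z. \<pi> i j z = - \<pi> j i z"
  shows "skew_biderivation (bracket e \<pi>)"
  unfolding skew_biderivation_def
proof (intro conjI allI impI)
  fix f g :: "'a \<Rightarrow> real" assume f: "smooth f" and g: "smooth g"
  show "smooth (bracket e \<pi> f g)"
    unfolding bracket_def by (intro smooth_sum smooth_mult assms(1) smooth_frechet_derivative f g)
  have "bracket e \<pi> f g z = - bracket e \<pi> g f z" for z
    unfolding bracket_def
    by (subst sum.swap, subst assms(2)) (simp add: sum_negf mult_ac)
  then show "bracket e \<pi> f g = (\<lambda>z. - bracket e \<pi> g f z)" by blast
  fix f' :: "'a \<Rightarrow> real" assume f': "smooth f'"
  show "bracket e \<pi> (\<lambda>z. f z + f' z) g = (\<lambda>z. bracket e \<pi> f g z + bracket e \<pi> f' g z)"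
    by (simp add: bracket_def frechet_derivative_add f f' algebra_simps sum.distrib)
  show "bracket e \<pi> (\<lambda>z. c * f z) g = (\<lambda>z. c * bracket e \<pi> f g z)" for c
    by (simp add: bracket_def frechet_derivative_mult smooth_const f algebra_simps sum_distrib_left)
  show "bracket e \<pi> (\<lambda>z. f z * f' z) g =
      (\<lambda>z. f z * bracket e \<pi> f' g z + bracket e \<pi> f g z * f' z)"
    by (simp add: bracket_def frechet_derivative_mult f f' algebra_simps sum.distrib sum_distrib_left)
qed

lemma flip_exterior_square:
  assumes "r \<in> exterior_square \<g>"
  shows "flip r = - r"
  using assms unfolding exterior_square_def
proof (induction r rule: span_induct_alt)
  case base
  then show ?case by (simp add: vec_eq_iff flip_def)
next
  case (step c x y)
  have "flip (wedge2 A B) = - wedge2 A B" for A B :: "'a mat1"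
    by (simp add: vec_eq_iff flip_def wedge2_def tensor_def)
  then have x: "flip x = - x" using step(1) by blast
  have "flip (c *\<^sub>R x + y) = c *\<^sub>R flip x + flip y"
    by (simp add: vec_eq_iff flip_def)
  then show ?case by (simp add: x step(2))
qed

lemma exterior_square_skew:
  assumes "r \<in> exterior_square \<g>"
  shows "r $ (k, j) $ (m, l) = - r $ (j, k) $ (l, m)"
proof -
  have "r $ (k, j) $ (m, l) = flip r $ (j, k) $ (l, m)" by (simp add: flip_def)
  then show ?thesis unfolding flip_exterior_square[OF assms] by simp
qed

lemma xx_bracket_skew:
  assumes "r \<in> exterior_square \<g>"
  shows "xx_bracket r j k x = - xx_bracket r k j x"
proof -
  have "xx_bracket r k j x = (\<Sum>m\<in>UNIV. \<Sum>l\<in>UNIV. r $ (k, j) $ (l, m) * x $ l * x $ m)"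
    unfolding xx_bracket_def by (rule sum.swap)
  then show ?thesis
    by (simp add: exterior_square_skew[OF assms, of k j] xx_bracket_def sum_negf mult_ac)
qed

lemma pp_bracket_skew:
  assumes "r \<in> exterior_square \<g>"
  shows "pp_bracket r l m p = - pp_bracket r m l p"
proof -
  have "pp_bracket r m l p = (\<Sum>k\<in>UNIV. \<Sum>j\<in>UNIV. p $ j * p $ k * r $ (j, k) $ (m, l))"
    unfolding pp_bracket_def by (rule sum.swap)
  then show ?thesis
    by (simp add: exterior_square_skew[OF assms, of _ _ m l] pp_bracket_def sum_negf mult_ac)
qed

lemma cotangent_bracket_skew:
  "r \<in> exterior_square \<g> \<Longrightarrow> cotangent_bracket r w a b z = - cotangent_bracket r w b a z"
  by (cases a; cases b; cases z)
    (simp_all, (erule xx_bracket_skew pp_bracket_skew)+)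

lemma smooth_component: "smooth (\<lambda>x. x $ i)" "smooth (\<lambda>z. fst z $ i)" "smooth (\<lambda>z. snd z $ i)"
  by (intro smooth_bounded_linear bounded_linear_vec_nth
      bounded_linear_compose[OF bounded_linear_vec_nth] bounded_linear_fst bounded_linear_snd)+

lemma smooth_minus: "smooth f \<Longrightarrow> smooth (\<lambda>x. - f x)"
  using smooth_mult[OF smooth_const[of "-1"], of f] by simp

lemma smooth_xx_bracket: "smooth (xx_bracket r j k)"
  unfolding xx_bracket_def by (intro smooth_sum smooth_mult smooth_const smooth_component)

lemma smooth_pp_bracket: "smooth (pp_bracket r l m)"
  unfolding pp_bracket_def by (intro smooth_sum smooth_mult smooth_const smooth_component)

lemma smooth_cotangent_bracket: "smooth (cotangent_bracket r w a b)"
proof -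
  have *: "cotangent_bracket r w (Inl j) (Inl k) = (\<lambda>z. xx_bracket r j k (fst z))"
    "cotangent_bracket r w (Inr l) (Inr m) = (\<lambda>z. pp_bracket r l m (snd z))"
    "cotangent_bracket r w (Inr l) (Inl k) = px_bracket w l k"
    "cotangent_bracket r w (Inl k) (Inr l) = (\<lambda>z. - px_bracket w l k z)" for j k l m
    by (simp_all add: fun_eq_iff)
  show ?thesis
    by (cases a; cases b; simp only: * xx_bracket_def pp_bracket_def px_bracket_def case_prod_beta')
      (intro smooth_minus smooth_sum smooth_mult smooth_const smooth_component)+
qed

theorem skew_biderivation_cotangent_bracket:
  "r \<in> exterior_square \<g> \<Longrightarrow> skew_biderivation (bracket cotangent_frame (cotangent_bracket r w))"
  by (intro skew_biderivation_bracket smooth_cotangent_bracket cotangent_bracket_skew)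

text \<open>Uniqueness rests on Hadamard's lemma.\<close>

lemma continuous_on_ray:
  fixes a :: "'a::euclidean_space"
  assumes "continuous_on UNIV h"
  shows "continuous_on S (\<lambda>z. h (a + snd z *\<^sub>R (fst z - a)))"
    and "continuous_on T (\<lambda>t. h (a + t *\<^sub>R (x - a)))"
  by (rule continuous_on_compose2[OF assms], intro continuous_intros, simp)+

lemma Ck_ray_integral:
  fixes a :: "'a::euclidean_space"
  shows "Ck k h \<Longrightarrow> Ck k (\<lambda>x. integral (cbox 0 1) (\<lambda>t::real. t ^ n * h (a + t *\<^sub>R (x - a))))"
proof (induction k arbitrary: h n)
  case 0
  show ?case
    unfolding Ck.simps
    by (rule integral_continuous_on_param)
      (unfold split_beta, intro continuous_on_ray[OF 0[unfolded Ck.simps]] continuous_intros)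
next
  case (Suc k)
  define H where "H x v = integral (cbox 0 1)
      (\<lambda>t::real. t ^ Suc n * frechet_derivative h (at (a + t *\<^sub>R (x - a))) v)" for x v
  define fx where "fx x t = (\<Sum>b\<in>Basis.
      (t ^ Suc n * frechet_derivative h (at (a + t *\<^sub>R (x - a))) b) *\<^sub>R blinfun_inner_left b)"
    for x t
  have conth: "continuous_on UNIV h" by (rule Ck_continuous[OF Suc.prems])
  have contD: "continuous_on UNIV (\<lambda>x. frechet_derivative h (at x) v)" for v
    by (rule Ck_continuous[OF Ck_SucD(2)[OF Suc.prems]])
  have lin: "linear (frechet_derivative h (at y))" for y
    using Suc.prems by (auto intro: linear_frechet_derivative)
  have expand: "(\<Sum>b\<in>Basis. frechet_derivative h (at y) b * (v \<bullet> b)) = frechet_derivative h (at y) v"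
    for y v
  proof -
    have "frechet_derivative h (at y) v = frechet_derivative h (at y) (\<Sum>b\<in>Basis. (v \<bullet> b) *\<^sub>R b)"
      by (simp add: euclidean_representation)
    then show ?thesis by (simp add: linear_sum[OF lin] linear_cmul[OF lin] mult_ac)
  qed
  have fx_apply: "blinfun_apply (fx x t) v
      = t ^ Suc n * frechet_derivative h (at (a + t *\<^sub>R (x - a))) v" for x t v
    unfolding expand[of _ v, symmetric]
    by (simp add: fx_def blinfun.sum_left blinfun.scaleR_left sum_distrib_left mult_ac inner_commute)
  have cont_fx: "continuous_on (UNIV \<times> cbox 0 1) (\<lambda>(x, t). fx x t)"
    unfolding fx_def split_beta by (intro continuous_on_ray[OF contD] continuous_intros)
  have der: "((\<lambda>x. integral (cbox 0 1) (\<lambda>t. t ^ n * h (a + t *\<^sub>R (x - a)))) has_derivative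
      blinfun_apply (integral (cbox 0 1) (fx x))) (at x)" for x
  proof (rule leibniz_rule[where U = UNIV])
    fix x t
    have "((\<lambda>x. t ^ n * h (a + t *\<^sub>R (x - a))) has_derivative
        (\<lambda>v. t ^ n * frechet_derivative h (at (a + t *\<^sub>R (x - a))) (t *\<^sub>R v))) (at x)"
      by (rule has_derivative_mult_right)
        (rule has_derivative_compose[of "\<lambda>x. a + t *\<^sub>R (x - a)", OF _ Ck_SucD(1)[OF Suc.prems]],
          auto intro!: derivative_eq_intros)
    then show "((\<lambda>x. t ^ n * h (a + t *\<^sub>R (x - a))) has_derivative blinfun_apply (fx x t)) (at x)"
      by (simp add: fx_apply[abs_def] linear_cmul[OF lin] mult_ac)
  next
    show "(\<lambda>t. t ^ n * h (a + t *\<^sub>R (x - a))) integrable_on cbox 0 1" for x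
      by (intro integrable_continuous continuous_on_ray[OF conth] continuous_intros)
  qed (use cont_fx in auto)
  have eq: "blinfun_apply (integral (cbox 0 1) (fx x)) v = H x v" for x v
  proof -
    have "continuous_on (cbox 0 1) (fx x)"
      unfolding fx_def by (intro continuous_on_ray[OF contD] continuous_intros)
    then have "integral (cbox 0 1) ((\<lambda>F. blinfun_apply F v) \<circ> fx x)
        = blinfun_apply (integral (cbox 0 1) (fx x)) v"
      by (intro integral_linear integrable_continuous blinfun.bounded_linear_left)
    then show ?thesis by (simp add: o_def fx_apply H_def)
  qed
  show ?case
    by (rule Ck_SucI[OF der]) (unfold eq H_def, rule Suc.IH, rule Ck_SucD(2)[OF Suc.prems])
qed

lemma hadamard:
  fixes f :: "'a::euclidean_space \<Rightarrow> real"
  assumes "frame e" "smooth f"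
  obtains h where "\<And>i. smooth (h i)" "\<And>i. h i a = frechet_derivative f (at a) (e i)"
    "f = (\<lambda>x. f a + (\<Sum>i\<in>UNIV. (coord e i x + (- coord e i a)) * h i x))"
proof -
  define h where "h i x = integral (cbox 0 1)
      (\<lambda>t::real. t ^ 0 * frechet_derivative f (at (a + t *\<^sub>R (x - a))) (e i))" for i x
  have lin: "linear (frechet_derivative f (at y))" for y
    using smooth_has_derivative[OF assms(2)] has_derivative_linear by blast
  have contD: "continuous_on UNIV (\<lambda>x. frechet_derivative f (at x) v)" for v
    using smooth_frechet_derivative[OF assms(2)] Ck_continuous unfolding smooth_def by blast
  have expand: "(\<Sum>i\<in>UNIV. coord e i v * frechet_derivative f (at y) (e i))
      = frechet_derivative f (at y) v" for y v
  proof -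
    have "v = (\<Sum>b\<in>Basis. (v \<bullet> b) *\<^sub>R b)" by (simp add: euclidean_representation)
    also have "\<dots> = (\<Sum>i\<in>UNIV. coord e i v *\<^sub>R e i)"
      unfolding coord_def
      using sum.reindex_bij_betw[OF assms(1)[unfolded frame_def], of "\<lambda>b. (v \<bullet> b) *\<^sub>R b"] by simp
    finally have "frechet_derivative f (at y) v
        = frechet_derivative f (at y) (\<Sum>i\<in>UNIV. coord e i v *\<^sub>R e i)" by simp
    then show ?thesis by (simp add: linear_sum[OF lin] linear_cmul[OF lin])
  qed
  have "f x = f a + (\<Sum>i\<in>UNIV. (coord e i x + (- coord e i a)) * h i x)" for x
  proof -
    have "((\<lambda>t. f (a + t *\<^sub>R (x - a))) has_vector_derivative
        frechet_derivative f (at (a + t *\<^sub>R (x - a))) (x - a)) (at t within {0..1})" for t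
      unfolding has_vector_derivative_def
      by (rule has_derivative_at_withinI,
          rule has_derivative_eq_rhs[OF has_derivative_compose[of "\<lambda>t. a + t *\<^sub>R (x - a)",
              OF _ smooth_has_derivative[OF assms(2)]]])
        (auto intro!: derivative_eq_intros simp: linear_cmul[OF lin])
    from fundamental_theorem_of_calculus[of 0 1, OF _ this]
    have "((\<lambda>t. frechet_derivative f (at (a + t *\<^sub>R (x - a))) (x - a)) has_integral f x - f a) {0..1}"
      by simp
    then have "f x - f a
        = integral {0..1} (\<lambda>t. frechet_derivative f (at (a + t *\<^sub>R (x - a))) (x - a))"
      by (simp add: integral_unique)
    also have "\<dots> = integral {0..1} (\<lambda>t. \<Sum>i\<in>UNIV.
        coord e i (x - a) * frechet_derivative f (at (a + t *\<^sub>R (x - a))) (e i))"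
      unfolding expand ..
    also have "\<dots> = (\<Sum>i\<in>UNIV. integral {0..1} (\<lambda>t.
        coord e i (x - a) * frechet_derivative f (at (a + t *\<^sub>R (x - a))) (e i)))"
      by (rule integral_sum)
        (simp, intro integrable_continuous_interval continuous_on_ray[OF contD] continuous_intros)
    also have "\<dots> = (\<Sum>i\<in>UNIV. (coord e i x + (- coord e i a)) * h i x)"
      by (simp add: h_def coord_def inner_diff_left)
    finally show ?thesis by simp
  qed
  moreover have "smooth (h i)" for i
    using smooth_frechet_derivative[OF assms(2)]
    unfolding smooth_def h_def by (intro allI Ck_ray_integral) blast
  moreover have "h i a = frechet_derivative f (at a) (e i)" for i
    by (simp add: h_def)
  ultimately show ?thesis using that by blast
qed

lemma derivation_coord:
  fixes D :: "('a::euclidean_space \<Rightarrow> real) \<Rightarrow> 'a \<Rightarrow> real"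
  assumes "frame e" "smooth f"
    and add: "\<And>f g. smooth f \<Longrightarrow> smooth g \<Longrightarrow> D (\<lambda>z. f z + g z) = (\<lambda>z. D f z + D g z)"
    and scale: "\<And>c f. smooth f \<Longrightarrow> D (\<lambda>z. c * f z) = (\<lambda>z. c * D f z)"
    and mult: "\<And>f g. smooth f \<Longrightarrow> smooth g \<Longrightarrow> D (\<lambda>z. f z * g z) = (\<lambda>z. f z * D g z + D f z * g z)"
  shows "D f a = (\<Sum>i\<in>UNIV. D (coord e i) a * frechet_derivative f (at a) (e i))"
proof -
  have "D (\<lambda>z. 1) = (\<lambda>z. 0)"
    using mult[OF smooth_const[of 1] smooth_const[of 1]] by (simp add: fun_eq_iff)
  then have const: "D (\<lambda>z. c) = (\<lambda>z. 0)" for c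
    using scale[OF smooth_const[of 1], of c] by simp
  have sum: "D (\<lambda>z. \<Sum>i\<in>I. F i z) a = (\<Sum>i\<in>I. D (F i) a)"
    if "finite I" "\<And>i. smooth (F i)" for F and I :: "'b set"
    using that by (induction I rule: finite_induct) (simp_all add: const add smooth_sum)
  obtain h where h: "\<And>i. smooth (h i)" "\<And>i. h i a = frechet_derivative f (at a) (e i)"
    "f = (\<lambda>x. f a + (\<Sum>i\<in>UNIV. (coord e i x + (- coord e i a)) * h i x))"
    using hadamard[OF assms(1,2), of a] by blast
  define u where "u i x = coord e i x + (- coord e i a)" for i x
  have u: "smooth (u i)" "u i a = 0" "D (u i) a = D (coord e i) a" for i
    unfolding u_def using add[OF smooth_coord smooth_const, of e i "- coord e i a"]
    by (auto intro: smooth_add smooth_coord smooth_const simp only: const)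
  have "D f a = D (\<lambda>x. f a + (\<Sum>i\<in>UNIV. u i x * h i x)) a"
    unfolding u_def h(3)[symmetric] ..
  also have "\<dots> = (\<Sum>i\<in>UNIV. D (\<lambda>x. u i x * h i x) a)"
    by (simp add: add smooth_const smooth_sum smooth_mult u h(1) const sum)
  also have "\<dots> = (\<Sum>i\<in>UNIV. D (coord e i) a * frechet_derivative f (at a) (e i))"
    by (simp add: mult u h(1,2))
  finally show ?thesis .
qed

theorem bracket_unique:
  assumes B: "skew_biderivation B" and e: "frame e"
    and \<pi>: "\<And>i j. B (coord e i) (coord e j) = \<pi> i j"
    and f: "smooth f" and g: "smooth g"
  shows "B f g = bracket e \<pi> f g"
proof
  fix a
  have left: "B f g a = (\<Sum>i\<in>UNIV. B (coord e i) g a * frechet_derivative f (at a) (e i))"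
    if "smooth f" "smooth g" for f g
    using B that(2) unfolding skew_biderivation_def
    by (intro derivation_coord[OF e that(1), of "\<lambda>f. B f g"]) blast+
  have skew: "B f g a = - B g f a" if "smooth f" "smooth g" for f g
    using B that unfolding skew_biderivation_def by metis
  have "B (coord e i) g a = (\<Sum>j\<in>UNIV. \<pi> i j a * frechet_derivative g (at a) (e j))" for i
    using skew[OF smooth_coord g, of e i] left[OF g smooth_coord, of e i]
      skew[OF smooth_coord smooth_coord, of e _ e i]
    by (simp add: \<pi> sum_negf)
  then show "B f g a = bracket e \<pi> f g a"
    unfolding left[OF f g] bracket_def
    by (simp add: sum_distrib_left sum_distrib_right mult_ac)
qed

end

theory Submission
  imports Defs
begin

text \<open>
  The Jacobiator of a skew biderivation is a derivation in each argument, so only coordinates matter.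
  On three \<open>x\<close> or three \<open>p\<close> it vanishes by assumption.  In tensor notation
  \<open>{x_1, x_2} = r_12 x_1 x_2\<close>, \<open>{p_1, p_2} = p_1 p_2 r_12\<close>, \<open>{p_1, x_2} = - p_1 w_12 x_2\<close>, and
  the Jacobiators of \<open>(p_1, x_2, x_3)\<close> and \<open>(p_1, p_2, x_3)\<close> are
  \<open>p_1 ([w_12, w_13] + [w_12 + w_13, r_23]) x_2 x_3\<close> and
  \<open>- p_1 p_2 ([r_12, w_13 + w_23] + [w_13, w_23]) x_3\<close>.  Both are the classical Yang--Baxter
  expression of \<open>w\<close> up to the commutators \<open>[w_12 + w_13, s_23]\<close> and \<open>[s_12, w_13 + w_23]\<close>, which
  vanish because \<open>s\<close> is invariant: \<open>w_12 + w_13\<close> applies the coproduct to the second leg of \<open>w\<close>,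
  and \<open>w_13 + w_23\<close> to the first.
\<close>


section \<open>The Jacobi identity for skew biderivations\<close>

lemma skew_biderivationD:
  assumes "skew_biderivation B" "smooth f" "smooth g"
  shows "smooth (B f g)" "B f g z = - B g f z"
  using assms unfolding skew_biderivation_def by metis+

lemma skew_biderivation_left:
  assumes "skew_biderivation B" "smooth f" "smooth f'" "smooth g"
  shows "B (\<lambda>z. f z + f' z) g = (\<lambda>z. B f g z + B f' g z)"
    and "B (\<lambda>z. c * f z) g = (\<lambda>z. c * B f g z)"
    and "B (\<lambda>z. f z * f' z) g = (\<lambda>z. f z * B f' g z + B f g z * f' z)"
  using assms unfolding skew_biderivation_def by blast+

lemma skew_biderivation_right:
  assumes B: "skew_biderivation B" and f: "smooth f" and f': "smooth f'" and g: "smooth g"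
  shows "B g (\<lambda>z. f z + f' z) = (\<lambda>z. B g f z + B g f' z)"
    and "B g (\<lambda>z. c * f z) = (\<lambda>z. c * B g f z)"
    and "B g (\<lambda>z. f z * f' z) = (\<lambda>z. f z * B g f' z + B g f z * f' z)"
proof -
  note left = skew_biderivation_left[OF B f f' g]
  note skew = skew_biderivationD(2)[OF B g]
  show "B g (\<lambda>z. f z + f' z) = (\<lambda>z. B g f z + B g f' z)"
    by (simp add: fun_eq_iff skew[OF smooth_add[OF f f']] skew[OF f] skew[OF f'] left)
  show "B g (\<lambda>z. c * f z) = (\<lambda>z. c * B g f z)"
    by (simp add: fun_eq_iff skew[OF smooth_mult[OF smooth_const f]] skew[OF f] left)
  show "B g (\<lambda>z. f z * f' z) = (\<lambda>z. f z * B g f' z + B g f z * f' z)"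
    by (simp add: fun_eq_iff skew[OF smooth_mult[OF f f']] skew[OF f] skew[OF f'] left)
qed

lemma skew_biderivation_sum:
  assumes B: "skew_biderivation B" and g: "smooth g" and F: "\<And>i. i \<in> I \<Longrightarrow> smooth (F i)"
  shows "B g (\<lambda>z. \<Sum>i\<in>I. F i z) = (\<lambda>z. \<Sum>i\<in>I. B g (F i) z)"
  using F
proof (induction I rule: infinite_finite_induct)
  case (insert i I)
  then have "B g (\<lambda>z. F i z + (\<Sum>i\<in>I. F i z)) = (\<lambda>z. B g (F i) z + B g (\<lambda>z. \<Sum>i\<in>I. F i z) z)"
    by (intro skew_biderivation_right[OF B] smooth_sum g) auto
  with insert show ?case by simp
\<comment> \<open>Over an empty or infinite index set the sum is the zero function, which the
  bracket kills by homogeneity with scalar 0.\<close>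
qed (use skew_biderivation_right(2)[OF B smooth_const smooth_const g, of 0] in simp_all)

text \<open>All coordinate brackets are quadratic, so this expansion evaluates the outer bracket of
  every double bracket of coordinates. Two families \<open>X\<close> and \<open>Y\<close> are
  allowed because the mixed bracket is bilinear in \<open>p\<close> and \<open>x\<close>.\<close>

lemma skew_biderivation_bilinear:
  assumes B: "skew_biderivation B" and g: "smooth g"
    and X: "\<And>i. smooth (X i)" and Y: "\<And>i. smooth (Y i)"
  shows "B g (\<lambda>z. \<Sum>l\<in>I. \<Sum>m\<in>K. c l m * (X l z * Y m z)) z
    = (\<Sum>l\<in>I. \<Sum>m\<in>K. c l m * (B g (X l) z * Y m z + X l z * B g (Y m) z))"
proof -
  have XY: "smooth (\<lambda>z. X l z * Y m z)" for l m
    by (intro smooth_mult X Y)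
  have "B g (\<lambda>z. c l m * (X l z * Y m z)) z = c l m * (B g (X l) z * Y m z + X l z * B g (Y m) z)"
    for l m
    by (simp add: skew_biderivation_right(2)[OF B XY XY g] skew_biderivation_right(3)[OF B X Y g])
  moreover have "smooth (\<lambda>z. c l m * (X l z * Y m z))" for l m
    by (intro smooth_mult smooth_const X Y)
  ultimately show ?thesis
    by (simp add: skew_biderivation_sum[OF B g] smooth_sum)
qed

section \<open>The Jacobiator and its reduction to coordinates\<close>

definition jacobiator ::
  "(('a \<Rightarrow> real) \<Rightarrow> ('a \<Rightarrow> real) \<Rightarrow> 'a \<Rightarrow> real) \<Rightarrow>
    ('a \<Rightarrow> real) \<Rightarrow> ('a \<Rightarrow> real) \<Rightarrow> ('a \<Rightarrow> real) \<Rightarrow> 'a \<Rightarrow> real" where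
  "jacobiator B f g h = (\<lambda>z. B f (B g h) z + B g (B h f) z + B h (B f g) z)"

lemma jacobiator_cyclic: "jacobiator B f g h = jacobiator B g h f"
  by (simp add: jacobiator_def add_ac)

lemma jacobi_identity_jacobiator:
  "jacobi_identity B \<longleftrightarrow>
    (\<forall>f g h. smooth f \<longrightarrow> smooth g \<longrightarrow> smooth h \<longrightarrow> (\<forall>z. jacobiator B f g h z = 0))"
  by (simp add: jacobi_identity_def jacobiator_def)

text \<open>
  The Jacobiator is again a derivation in each argument (the second-order terms cancel by
  skew-symmetry), so it is determined by its values on coordinates.
\<close>

lemma jacobiator_coord:
  fixes B :: "('a::euclidean_space \<Rightarrow> real) \<Rightarrow> ('a \<Rightarrow> real) \<Rightarrow> 'a \<Rightarrow> real"
  assumes e: "frame e" and B: "skew_biderivation B"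
    and f: "smooth f" and g: "smooth g" and h: "smooth h"
  shows "jacobiator B f g h a
    = (\<Sum>i\<in>UNIV. jacobiator B (coord e i) g h a * frechet_derivative f (at a) (e i))"
proof (rule derivation_coord[OF e f, of "\<lambda>f. jacobiator B f g h"])
  note L = skew_biderivation_left[OF B] and R = skew_biderivation_right[OF B]
    and S = skew_biderivationD(1)[OF B] and skew = skew_biderivationD(2)[OF B]
  fix u v :: "'a \<Rightarrow> real" assume u: "smooth u" and v: "smooth v"
  note sm = u v g h S[OF g h] S[OF h u] S[OF h v] S[OF u g] S[OF v g]
  show "jacobiator B (\<lambda>z. u z + v z) g h = (\<lambda>z. jacobiator B u g h z + jacobiator B v g h z)"
    by (simp add: jacobiator_def fun_eq_iff L(1) R(1) sm)
  show "jacobiator B (\<lambda>z. c * u z) g h = (\<lambda>z. c * jacobiator B u g h z)" for c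
    by (simp add: jacobiator_def fun_eq_iff L(2)[OF u u] R(2)[OF u u] R(2)[OF sm(6) sm(6)]
        R(2)[OF sm(8) sm(8)] sm algebra_simps)
  \<comment> \<open>Only two of the three double brackets produce products of first-order terms.
    They are the same two products in both, and \<open>skew\<close> gives them opposite
    signs.\<close>
  have "B g (B h (\<lambda>z. u z * v z)) = (\<lambda>z. (u z * B g (B h v) z + B g u z * B h v z)
      + (B h u z * B g v z + B g (B h u) z * v z))"
    by (simp add: R(3)[OF u v h] R(1)[OF smooth_mult[OF u sm(7)] smooth_mult[OF sm(6) v] g]
        R(3)[OF u sm(7) g] R(3)[OF sm(6) v g])
  moreover have "B h (B (\<lambda>z. u z * v z) g) = (\<lambda>z. (u z * B h (B v g) z + B h u z * B v g z)
      + (B u g z * B h v z + B h (B u g) z * v z))"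
    by (simp add: L(3)[OF u v g] R(1)[OF smooth_mult[OF u sm(9)] smooth_mult[OF sm(8) v] h]
        R(3)[OF u sm(9) h] R(3)[OF sm(8) v h])
  ultimately show "jacobiator B (\<lambda>z. u z * v z) g h
      = (\<lambda>z. u z * jacobiator B v g h z + jacobiator B u g h z * v z)"
    by (simp add: jacobiator_def fun_eq_iff L(3)[OF u v sm(5)] skew[OF v g] skew[OF u g]
        algebra_simps)
qed

text \<open>Arguments are exchanged for coordinates one at a time: \<open>jacobiator_coord\<close>
  handles the first slot, and cyclic symmetry then rotates the next argument into it.\<close>

lemma jacobi_identityI:
  fixes B :: "('a::euclidean_space \<Rightarrow> real) \<Rightarrow> ('a \<Rightarrow> real) \<Rightarrow> 'a \<Rightarrow> real"
  assumes e: "frame e" and B: "skew_biderivation B"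
    and J: "\<And>i j k z. jacobiator B (coord e i) (coord e j) (coord e k) z = 0"
  shows "jacobi_identity B"
  unfolding jacobi_identity_jacobiator
proof (intro allI impI)
  fix f g h :: "'a \<Rightarrow> real" and z assume sm: "smooth f" "smooth g" "smooth h"
  note jac = jacobiator_coord[OF e B]
  have "jacobiator B h (coord e i) (coord e j) z = 0" for i j
    by (subst jac) (simp_all add: J sm smooth_coord)
  then have "jacobiator B g h (coord e i) z = 0" for i
    by (subst jac) (simp_all add: jacobiator_cyclic[of B _ h] sm smooth_coord)
  then show "jacobiator B f g h z = 0"
    by (subst jac) (simp_all add: jacobiator_cyclic[of B _ g] sm)
qed

text \<open>The right side depends only on the structure constants and the numbers
  \<open>X i z\<close>. Hence brackets on different spaces that share structure constants have equal
  Jacobiators at points with equal coordinates, which carries the Jacobi identity from the base or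
  the fibre to the cotangent space.\<close>

lemma quadratic_jacobiator:
  fixes X :: "'i::finite \<Rightarrow> 'a::euclidean_space \<Rightarrow> real"
  assumes B: "skew_biderivation B" and X: "\<And>i. smooth (X i)"
    and c: "\<And>j k. B (X j) (X k) = (\<lambda>z. q j k (\<lambda>i. X i z))"
    and q: "\<And>j k x. q j k x = (\<Sum>l\<in>UNIV. \<Sum>m\<in>UNIV. c j k l m * (x l * x m))"
  shows "jacobiator B (X i) (X j) (X k) z =
    (let x = (\<lambda>i. X i z);
       d = (\<lambda>i j k. \<Sum>l\<in>UNIV. \<Sum>m\<in>UNIV. c j k l m * (q i l x * x m + x l * q i m x))
     in d i j k + d j k i + d k i j)"
proof -
  have "B (X i) (B (X j) (X k)) z =
      (\<Sum>l\<in>UNIV. \<Sum>m\<in>UNIV. c j k l m * (B (X i) (X l) z * X m z + X l z * B (X i) (X m) z))"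
    for i j k
    unfolding c[of j k] q by (rule skew_biderivation_bilinear[OF B X X X])
  then show ?thesis
    \<comment> \<open>The double brackets are expanded first; rewriting with \<open>c\<close> at
      once would destroy the inner brackets that the expansion has to match.\<close>
    by (simp add: jacobiator_def Let_def) (simp add: c)
qed


section \<open>Tensor computations\<close>

lemma sum_UNIV_prod:
  "(\<Sum>i\<in>(UNIV :: ('a::finite \<times> 'b::finite) set). f i)
      = (\<Sum>a\<in>UNIV. \<Sum>b\<in>UNIV. f (a, b))"
  by (simp add: sum.cartesian_product)

lemma sum_if_const: "(\<Sum>i\<in>I. if P then f i else 0) = (if P then \<Sum>i\<in>I. f i else 0)"
  by simp

text \<open>Two different placements share exactly one tensor factor. Matrix multiplication there
  leaves the sum over \<open>d\<close>; the identity factors collapse the other two sums.\<close>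

lemma leg_mult_component:
  fixes A B :: "'n::finite mat2"
  shows "(leg12 A ** leg13 B) $ (a, b, c) $ (a', b', c')
      = (\<Sum>d\<in>UNIV. A $ (a, b) $ (d, b') * B $ (d, c) $ (a', c'))"
    and "(leg13 A ** leg12 B) $ (a, b, c) $ (a', b', c')
      = (\<Sum>d\<in>UNIV. A $ (a, c) $ (d, c') * B $ (d, b) $ (a', b'))"
    and "(leg12 A ** leg23 B) $ (a, b, c) $ (a', b', c')
      = (\<Sum>d\<in>UNIV. A $ (a, b) $ (a', d) * B $ (d, c) $ (b', c'))"
    and "(leg23 A ** leg12 B) $ (a, b, c) $ (a', b', c')
      = (\<Sum>d\<in>UNIV. A $ (b, c) $ (d, c') * B $ (a, d) $ (a', b'))"
    and "(leg13 A ** leg23 B) $ (a, b, c) $ (a', b', c')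
      = (\<Sum>d\<in>UNIV. A $ (a, c) $ (a', d) * B $ (b, d) $ (b', c'))"
    and "(leg23 A ** leg13 B) $ (a, b, c) $ (a', b', c')
      = (\<Sum>d\<in>UNIV. A $ (b, c) $ (b', d) * B $ (a, d) $ (a', c'))"
  by (simp_all add: matrix_matrix_mult_def leg12_def leg13_def leg23_def sum_UNIV_prod
      mult_delta_left mult_delta_right sum_if_const)

text \<open>Normal form for a quadratic bracket substituted into the first factor of a quadratic
  expression. The contracted index \<open>l\<close> moves innermost, where its sum can be recognised
  as a component of a product of legs.\<close>

lemma nested_sum_left:
  fixes c :: "'i::finite \<Rightarrow> 'j::finite \<Rightarrow> real" and d :: "'i \<Rightarrow> 'k::finite \<Rightarrow> 'l::finite \<Rightarrow> real"
  shows "(\<Sum>l\<in>UNIV. \<Sum>k\<in>UNIV. c l k * ((\<Sum>u\<in>UNIV. \<Sum>v\<in>UNIV. d l u v * (f u * g v)) * h k))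
   
      = (\<Sum>u\<in>UNIV. \<Sum>v\<in>UNIV. \<Sum>k\<in>UNIV. (\<Sum>l\<in>UNIV. c l k * d l u v) * (f u * g v * h k))"
proof -
  have "(\<Sum>l\<in>UNIV. \<Sum>k\<in>UNIV. c l k * ((\<Sum>u\<in>UNIV. \<Sum>v\<in>UNIV. d l u v * (f u * g v)) * h k))
     
      = (\<Sum>l\<in>UNIV. \<Sum>k\<in>UNIV. \<Sum>u\<in>UNIV. \<Sum>v\<in>UNIV. c l k * d l u v * (f u * g v * h k))"
    by (simp add: sum_distrib_left sum_distrib_right mult_ac)
  also have "\<dots>
      = (\<Sum>u\<in>UNIV. \<Sum>v\<in>UNIV. \<Sum>k\<in>UNIV. \<Sum>l\<in>UNIV. c l k * d l u v * (f u * g v * h k))"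
    unfolding sum.cartesian_product
    by (rule sum.reindex_bij_witness[of _ "\<lambda>(u, v, k, l). (l, k, u, v)" "\<lambda>(l, k, u, v). (u, v, k, l)"])
      auto
  finally show ?thesis
    by (simp add: sum_distrib_right)
qed

text \<open>The same normal form for substitution into the second factor.\<close>

lemma nested_sum_right:
  fixes c :: "'j::finite \<Rightarrow> 'i::finite \<Rightarrow> real" and d :: "'i \<Rightarrow> 'k::finite \<Rightarrow> 'l::finite \<Rightarrow> real"
  shows "(\<Sum>k\<in>UNIV. \<Sum>l\<in>UNIV. c k l * (h k * (\<Sum>u\<in>UNIV. \<Sum>v\<in>UNIV. d l u v * (f u * g v))))
   
      = (\<Sum>k\<in>UNIV. \<Sum>u\<in>UNIV. \<Sum>v\<in>UNIV. (\<Sum>l\<in>UNIV. c k l * d l u v) * (h k * f u * g v))"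
proof -
  have "(\<Sum>k\<in>UNIV. \<Sum>l\<in>UNIV. c k l * (h k * (\<Sum>u\<in>UNIV. \<Sum>v\<in>UNIV. d l u v * (f u * g v))))
     
      = (\<Sum>k\<in>UNIV. \<Sum>l\<in>UNIV. \<Sum>u\<in>UNIV. \<Sum>v\<in>UNIV. c k l * d l u v * (h k * f u * g v))"
    by (simp add: sum_distrib_left mult_ac)
  also have "\<dots>
      = (\<Sum>k\<in>UNIV. \<Sum>u\<in>UNIV. \<Sum>v\<in>UNIV. \<Sum>l\<in>UNIV. c k l * d l u v * (h k * f u * g v))"
    unfolding sum.cartesian_product
    by (rule sum.reindex_bij_witness[of _ "\<lambda>(k, u, v, l). (k, l, u, v)" "\<lambda>(k, l, u, v). (k, u, v, l)"])
      auto
  finally show ?thesis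
    by (simp add: sum_distrib_right)
qed

section \<open>Invariance of \<open>s\<close> as vanishing commutators of legs\<close>

lemma leg_linear:
  "leg12 (x + y) = leg12 x + leg12 y" "leg13 (x + y) = leg13 x + leg13 y"
  "leg23 (x + y) = leg23 x + leg23 y"
  "leg12 (c *\<^sub>R x) = c *\<^sub>R leg12 x" "leg13 (c *\<^sub>R x) = c *\<^sub>R leg13 x"
  "leg12 0 = 0" "leg13 0 = 0" "leg23 (c *\<^sub>R x) = c *\<^sub>R leg23 x" "leg23 0 = 0"
  by (simp_all add: vec_eq_iff leg12_def leg13_def leg23_def algebra_simps)

lemma matrix_add_rdistrib: "(A + B) ** C = A ** C + B ** (C :: real ^ 'a ^ 'b::finite)"
  by (simp add: vec_eq_iff matrix_matrix_mult_def algebra_simps sum.distrib)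

text \<open>Triples nest to the right, so this placement is a binary tensor product and
  \<open>tensor_mult\<close> applies to it. For legs 1 and 2 of a general element,
  \<open>leg12_mult\<close> does that work.\<close>

lemma leg23_eq_tensor: "leg23 \<rho> = mat 1 \<otimes>\<^sub>M \<rho>"
  by (simp add: vec_eq_iff leg23_def tensor_def mat_def)

lemma leg12_mult: "leg12 (\<rho> ** \<sigma>) = leg12 \<rho> ** leg12 \<sigma>"
  by (simp add: vec_eq_iff matrix_matrix_mult_def leg12_def sum_UNIV_prod
      mult_delta_left mult_delta_right sum_if_const)


text \<open>By linearity take \<open>w = A \<otimes>\<^sub>M B\<close>. Then the sum of legs is
  \<open>A\<close> tensored with the coproduct of \<open>B\<close>, and invariance says that this
  coproduct commutes with \<open>s\<close>.\<close>

lemma commutator_leg23: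
  assumes w: "w \<in> tensor_square \<g>" and s: "invariant2 \<g> s"
  shows "commutator (leg12 w + leg13 w) (leg23 s) = 0"
  using w unfolding tensor_square_def
proof (induction w rule: span_induct_alt)
  case base
  show ?case by (simp add: leg_linear commutator_def)
next
  case (step c x y)
  then obtain A B where x: "x = A \<otimes>\<^sub>M B" and "B \<in> \<g>" by blast
  have "leg12 x + leg13 x = A \<otimes>\<^sub>M (B \<otimes>\<^sub>M mat 1 + mat 1 \<otimes>\<^sub>M B)"
    by (simp add: x leg12_tensor leg13_tensor linear_add[OF linear_tensor(2)])
  then have "commutator (leg12 x + leg13 x) (leg23 s)
      = A \<otimes>\<^sub>M commutator (B \<otimes>\<^sub>M mat 1 + mat 1 \<otimes>\<^sub>M B) s"
    by (simp add: leg23_eq_tensor commutator_def tensor_mult linear_diff[OF linear_tensor(2)])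
  also have "\<dots> = 0"
    using s \<open>B \<in> \<g>\<close> by (simp add: invariant2_def linear_0[OF linear_tensor(2)])
  finally have "commutator (leg12 x + leg13 x) (leg23 s) = 0" .
  moreover have "leg12 (c *\<^sub>R x + y) + leg13 (c *\<^sub>R x + y)
      = c *\<^sub>R (leg12 x + leg13 x) + (leg12 y + leg13 y)"
    by (simp add: leg_linear algebra_simps)
  ultimately show ?case
    using step(2) by (simp add: linear_add[OF linear_commutator(1)] linear_cmul[OF linear_commutator(1)])
qed

text \<open>Mirror image, with the coproduct now applied to the first leg of
  \<open>A \<otimes>\<^sub>M B\<close>. Since triples nest to the right, the third leg is split off
  as a separate matrix factor.\<close>

lemma commutator_leg12:
  assumes w: "w \<in> tensor_square \<g>" and s: "invariant2 \<g> s"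
  shows "commutator (leg12 s) (leg13 w + leg23 w) = 0"
  using w unfolding tensor_square_def
proof (induction w rule: span_induct_alt)
  case base
  show ?case by (simp add: leg_linear commutator_def)
next
  case (step c x y)
  then obtain A B where x: "x = A \<otimes>\<^sub>M B" and "A \<in> \<g>" by blast
  \<comment> \<open>\<open>D\<close> is the coproduct of \<open>A\<close>. \<open>Z\<close> acts on
    the third factor alone, so it commutes with \<open>leg12 s\<close> and only the commutator of
    \<open>s\<close> with \<open>D\<close> remains.\<close>
  define D where "D = A \<otimes>\<^sub>M mat 1 + mat 1 \<otimes>\<^sub>M A"
  define Z where "Z = (mat 1 :: 'a mat1) \<otimes>\<^sub>M (mat 1 :: 'a mat1) \<otimes>\<^sub>M B"
  have xZ: "leg13 x + leg23 x = leg12 D ** Z"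
    by (simp add: x D_def Z_def leg_linear leg12_tensor leg13_tensor leg23_tensor tensor_mult
        matrix_add_rdistrib)
  have "Z ** leg12 s = leg12 s ** Z"
    by (simp add: vec_eq_iff Z_def matrix_matrix_mult_def leg12_def tensor_def mat_def sum_UNIV_prod
        mult_delta_left mult_delta_right sum_if_const)
  then have "leg12 D ** Z ** leg12 s = leg12 D ** leg12 s ** Z"
    by (metis matrix_mul_assoc)
  then have "commutator (leg12 s) (leg13 x + leg23 x) = leg12 (s ** D) ** Z - leg12 (D ** s) ** Z"
    by (simp add: commutator_def xZ leg12_mult matrix_mul_assoc)
  moreover have "s ** D = D ** s"
    using s \<open>A \<in> \<g>\<close> by (simp add: invariant2_def commutator_def D_def)
  ultimately have "commutator (leg12 s) (leg13 x + leg23 x) = 0" by simp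
  moreover have "leg13 (c *\<^sub>R x + y) + leg23 (c *\<^sub>R x + y)
      = c *\<^sub>R (leg13 x + leg23 x) + (leg13 y + leg23 y)"
    by (simp add: leg_linear algebra_simps)
  ultimately show ?case
    using step(2) by (simp add: linear_add[OF linear_commutator(2)] linear_cmul[OF linear_commutator(2)])
qed

lemma exterior_square_subset: "exterior_square \<g> \<subseteq> tensor_square \<g>"
  unfolding exterior_square_def tensor_square_def wedge2_def
  by (rule span_minimal) (auto intro!: span_diff intro: span_base)

text \<open>Replacing \<open>w\<close> by \<open>r\<close> in leg 23, respectively leg 12, changes
  \<open>cyb w\<close> by a commutator with a leg of \<open>s\<close>, which vanishes by invariance.
  These are the two expressions that the mixed Jacobiators produce.\<close>

lemma cyb_skew_part:
  assumes w: "w \<in> tensor_square \<g>" and s: "invariant2 \<g> s" and "w = r + s" and "cyb w = 0"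
  shows "commutator (leg12 w) (leg13 w) + commutator (leg12 w + leg13 w) (leg23 r) = 0"
    and "commutator (leg12 r) (leg13 w + leg23 w) + commutator (leg13 w) (leg23 w) = 0"
proof -
  have r: "leg12 r = leg12 w - leg12 s" "leg23 r = leg23 w - leg23 s"
    by (simp_all add: assms(3) leg_linear)
  have "commutator (leg12 w) (leg13 w) + commutator (leg12 w + leg13 w) (leg23 r)
      = cyb w - commutator (leg12 w + leg13 w) (leg23 s)"
    unfolding r cyb_def
    by (simp add: linear_add[OF linear_commutator(1)] linear_diff[OF linear_commutator(2)])
  then show "commutator (leg12 w) (leg13 w) + commutator (leg12 w + leg13 w) (leg23 r) = 0"
    using assms(4) commutator_leg23[OF w s] by simp
  have "commutator (leg12 r) (leg13 w + leg23 w) + commutator (leg13 w) (leg23 w)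
      = cyb w - commutator (leg12 s) (leg13 w + leg23 w)"
    unfolding r cyb_def
    by (simp add: linear_add[OF linear_commutator(2)] linear_diff[OF linear_commutator(1)])
  then show "commutator (leg12 r) (leg13 w + leg23 w) + commutator (leg13 w) (leg23 w) = 0"
    using assms(4) commutator_leg12[OF w s] by simp
qed


section \<open>The bracket on the cotangent space\<close>

context
  fixes r w :: "'n::finite mat2" and \<g> :: "('n mat1) set"
  assumes r: "r \<in> exterior_square \<g>"
begin

private abbreviation (input) B where "B \<equiv> bracket cotangent_frame (cotangent_bracket r w)"
private abbreviation (input) X where "X i \<equiv> coord cotangent_frame (Inl i)"
private abbreviation (input) P where "P i \<equiv> coord cotangent_frame (Inr i)"

private lemmas skewB = skew_biderivation_cotangent_bracket[OF r, of w]

lemma coord_apply: "X i z = fst z $ i" "P i z = snd z $ i"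
  by (cases z; simp add: coord_cotangent_frame)+

text \<open>Brings the brackets into the shape expected by \<open>skew_biderivation_bilinear\<close>
  and the nested sums. The mixed bracket is listed in both orders so that its sign is already
  settled.\<close>

lemma bracket_XP:
  "B (X j) (X k) = (\<lambda>z. \<Sum>l\<in>UNIV. \<Sum>m\<in>UNIV. r $ (j, k) $ (l, m) * (X l z * X m z))"
  "B (P j) (P k) = (\<lambda>z. \<Sum>l\<in>UNIV. \<Sum>m\<in>UNIV. r $ (l, m) $ (j, k) * (P l z * P m z))"
  "B (P j) (X k) = (\<lambda>z. \<Sum>l\<in>UNIV. \<Sum>m\<in>UNIV. - w $ (l, k) $ (j, m) * (P l z * X m z))"
  "B (X k) (P j) = (\<lambda>z. \<Sum>l\<in>UNIV. \<Sum>m\<in>UNIV. w $ (l, k) $ (j, m) * (P l z * X m z))"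
  by (simp_all add: bracket_coord[OF frame_cotangent_frame] fun_eq_iff coord_apply
      xx_bracket_def pp_bracket_def px_bracket_def sum_negf mult_ac)

text \<open>The coordinates \<open>x\<close> have the same structure constants on the base as on the
  cotangent space, so \<open>quadratic_jacobiator\<close> identifies this Jacobiator with the one on
  the base at \<open>fst z\<close>.\<close>

lemma jacobiator_XXX:
  assumes "jacobi_identity (bracket vec_frame (xx_bracket r))"
  shows "jacobiator B (X i) (X j) (X k) z = 0"
proof -
  let ?q = "\<lambda>j k x. \<Sum>l\<in>UNIV. \<Sum>m\<in>UNIV. r $ (j, k) $ (l, m) * (x l * x m)"
  have V: "skew_biderivation (bracket vec_frame (xx_bracket r))"
    by (intro skew_biderivation_bracket smooth_xx_bracket xx_bracket_skew[OF r])
  have V_coord: "bracket vec_frame (xx_bracket r) (coord vec_frame j) (coord vec_frame k)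
      = (\<lambda>z. \<Sum>l\<in>UNIV. \<Sum>m\<in>UNIV. r $ (j, k) $ (l, m) * (coord vec_frame l z * coord vec_frame m z))"
      for j k
    by (simp add: bracket_coord[OF frame_vec_frame] fun_eq_iff coord_vec_frame xx_bracket_def mult_ac)
  have "jacobiator B (X i) (X j) (X k) z
      = jacobiator (bracket vec_frame (xx_bracket r))
          (coord vec_frame i) (coord vec_frame j) (coord vec_frame k) (fst z)"
    unfolding quadratic_jacobiator[OF skewB, where X = X and q = ?q, OF smooth_coord bracket_XP(1) refl]
      quadratic_jacobiator[OF V, where X = "coord vec_frame" and q = ?q, OF smooth_coord V_coord refl]
    by (simp only: coord_apply coord_vec_frame)
  with assms show ?thesis
    by (simp add: jacobi_identity_jacobiator smooth_coord)
qed

text \<open>The same comparison with the dual space, at \<open>snd z\<close>.\<close>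

lemma jacobiator_PPP:
  assumes "jacobi_identity (bracket vec_frame (pp_bracket r))"
  shows "jacobiator B (P i) (P j) (P k) z = 0"
proof -
  let ?q = "\<lambda>j k x. \<Sum>l\<in>UNIV. \<Sum>m\<in>UNIV. r $ (l, m) $ (j, k) * (x l * x m)"
  have V: "skew_biderivation (bracket vec_frame (pp_bracket r))"
    by (intro skew_biderivation_bracket smooth_pp_bracket pp_bracket_skew[OF r])
  have V_coord: "bracket vec_frame (pp_bracket r) (coord vec_frame j) (coord vec_frame k)
      = (\<lambda>z. \<Sum>l\<in>UNIV. \<Sum>m\<in>UNIV. r $ (l, m) $ (j, k) * (coord vec_frame l z * coord vec_frame m z))"
      for j k
    by (simp add: bracket_coord[OF frame_vec_frame] fun_eq_iff coord_vec_frame pp_bracket_def mult_ac)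
  have "jacobiator B (P i) (P j) (P k) z
      = jacobiator (bracket vec_frame (pp_bracket r))
          (coord vec_frame i) (coord vec_frame j) (coord vec_frame k) (snd z)"
    unfolding quadratic_jacobiator[OF skewB, where X = P and q = ?q, OF smooth_coord bracket_XP(2) refl]
      quadratic_jacobiator[OF V, where X = "coord vec_frame" and q = ?q, OF smooth_coord V_coord refl]
    by (simp only: coord_apply coord_vec_frame)
  with assms show ?thesis
    by (simp add: jacobi_identity_jacobiator smooth_coord)
qed

lemma jacobiator_PXX:
  assumes "commutator (leg12 w) (leg13 w) + commutator (leg12 w + leg13 w) (leg23 r) = 0"
  shows "jacobiator B (P a) (X b) (X c) z = 0"
proof -
  \<comment> \<open>\<open>con T\<close> is the component with free indices \<open>a\<close>,
    \<open>b\<close>, \<open>c\<close> of \<open>p_1 T x_2 x_3\<close>. The variants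
    \<open>con_imn\<close> and \<open>con_inm\<close> only reorder the sums, to match the order in
    which the nested sums arise.\<close>
  define con where "con T = (\<Sum>i\<in>UNIV. \<Sum>n\<in>UNIV. \<Sum>m\<in>UNIV.
      T $ (i, b, c) $ (a, n, m) * (P i z * X n z * X m z))" for T :: "'n mat3"
  have con_diff: "con (S - T) = con S - con T" and con_add: "con (S + T) = con S + con T" for S T
    by (simp_all add: con_def sum_subtractf sum.distrib algebra_simps)
  have con_imn: "con T
      = (\<Sum>i\<in>UNIV. \<Sum>m\<in>UNIV. \<Sum>n\<in>UNIV. T $ (i, b, c) $ (a, n, m) * (P i z * X n z * X m z))"
    and con_inm: "con T
      = (\<Sum>n\<in>UNIV. \<Sum>i\<in>UNIV. \<Sum>m\<in>UNIV. T $ (i, b, c) $ (a, n, m) * (P i z * X n z * X m z))" for T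
    unfolding con_def by (rule sum.cong[OF refl sum.swap], rule sum.swap)
  \<comment> \<open>Brackets of \<open>X c\<close> with another \<open>x\<close> carry
    \<open>c\<close> as first upper index of \<open>r\<close>, whereas \<open>leg23 r\<close> needs
    it second. Fixing \<open>c\<close> makes the skew-symmetry a one-way rewrite.\<close>
  note skew_c = exterior_square_skew[OF r, of c]
  \<comment> \<open>Each double bracket gives two Leibniz terms, and each term contracts a lower
    index of one tensor with an upper index of the other. The tensor contributing the lower index is
    the left factor of the matrix product.\<close>
  have "(\<Sum>l\<in>UNIV. \<Sum>m\<in>UNIV. r $ (b, c) $ (l, m) * (B (P a) (X l) z * X m z))
      = - con (leg23 r ** leg12 w)"
    unfolding bracket_XP nested_sum_left con_def
    by (simp add: leg_mult_component sum_negf mult_ac)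
  moreover have "(\<Sum>l\<in>UNIV. \<Sum>m\<in>UNIV. r $ (b, c) $ (l, m) * (X l z * B (P a) (X m) z))
      = - con (leg23 r ** leg13 w)"
    unfolding bracket_XP nested_sum_right con_inm
    by (simp add: leg_mult_component sum_negf mult_ac)
  ultimately have 1: "B (P a) (B (X b) (X c)) z = - con (leg23 r ** leg12 w) - con (leg23 r ** leg13 w)"
    unfolding bracket_XP(1) skew_biderivation_bilinear[OF skewB smooth_coord smooth_coord smooth_coord]
    by (simp only: distrib_left sum.distrib diff_conv_add_uminus)
  have "(\<Sum>i\<in>UNIV. \<Sum>m\<in>UNIV. w $ (i, c) $ (a, m) * (B (X b) (P i) z * X m z))
      = con (leg12 w ** leg13 w)"
    unfolding bracket_XP nested_sum_left con_def
    by (simp add: leg_mult_component sum_negf mult_ac)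
  moreover have "(\<Sum>i\<in>UNIV. \<Sum>m\<in>UNIV. w $ (i, c) $ (a, m) * (P i z * B (X b) (X m) z))
      = con (leg13 w ** leg23 r)"
    unfolding bracket_XP nested_sum_right con_def
    by (simp add: leg_mult_component sum_negf mult_ac)
  ultimately have 2: "B (X b) (B (X c) (P a)) z = con (leg12 w ** leg13 w) + con (leg13 w ** leg23 r)"
    unfolding bracket_XP(4) skew_biderivation_bilinear[OF skewB smooth_coord smooth_coord smooth_coord]
    by (simp only: distrib_left sum.distrib diff_conv_add_uminus)
  have "(\<Sum>i\<in>UNIV. \<Sum>m\<in>UNIV. - w $ (i, b) $ (a, m) * (B (X c) (P i) z * X m z))
      = - con (leg13 w ** leg12 w)"
    unfolding bracket_XP nested_sum_left con_imn
    by (simp add: leg_mult_component sum_negf mult_ac skew_c)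
  moreover have "(\<Sum>i\<in>UNIV. \<Sum>m\<in>UNIV. - w $ (i, b) $ (a, m) * (P i z * B (X c) (X m) z))
      = con (leg12 w ** leg23 r)"
    unfolding bracket_XP nested_sum_right con_imn
    by (simp add: leg_mult_component sum_negf mult_ac skew_c)
  ultimately have 3: "B (X c) (B (P a) (X b)) z = - con (leg13 w ** leg12 w) + con (leg12 w ** leg23 r)"
    unfolding bracket_XP(3) skew_biderivation_bilinear[OF skewB smooth_coord smooth_coord smooth_coord]
    by (simp only: distrib_left sum.distrib diff_conv_add_uminus)
  have "jacobiator B (P a) (X b) (X c) z
      = con (commutator (leg12 w) (leg13 w) + commutator (leg12 w + leg13 w) (leg23 r))"
    by (simp add: jacobiator_def 1 2 3 commutator_def con_diff con_add
        matrix_add_ldistrib matrix_add_rdistrib)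
  then show ?thesis
    by (simp add: assms con_def)
qed

lemma jacobiator_PPX:
  assumes "commutator (leg12 r) (leg13 w + leg23 w) + commutator (leg13 w) (leg23 w) = 0"
  shows "jacobiator B (P a) (P b) (X c) z = 0"
proof -
  \<comment> \<open>Here \<open>con T\<close> is the component of \<open>p_1 p_2 T x_3\<close>; the
    six Leibniz terms are matched with products of legs as for one \<open>p\<close> and two
    \<open>x\<close>.\<close>
  define con where "con T = (\<Sum>i\<in>UNIV. \<Sum>j\<in>UNIV. \<Sum>m\<in>UNIV.
      T $ (i, j, c) $ (a, b, m) * (P i z * P j z * X m z))" for T :: "'n mat3"
  have con_diff: "con (S - T) = con S - con T" and con_add: "con (S + T) = con S + con T" for S T
    by (simp_all add: con_def sum_subtractf sum.distrib algebra_simps)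
  have con_jim: "con T
      = (\<Sum>j\<in>UNIV. \<Sum>i\<in>UNIV. \<Sum>m\<in>UNIV. T $ (i, j, c) $ (a, b, m) * (P i z * P j z * X m z))"
    and con_imj: "con T
      = (\<Sum>i\<in>UNIV. \<Sum>m\<in>UNIV. \<Sum>j\<in>UNIV. T $ (i, j, c) $ (a, b, m) * (P i z * P j z * X m z))" for T
    unfolding con_def by (rule sum.swap, rule sum.cong[OF refl sum.swap])
  \<comment> \<open>The bracket of \<open>P b\<close> with another \<open>p\<close> has
    \<open>b\<close> as first lower index of \<open>r\<close>; it must become the second to fit
    \<open>leg12 r\<close>.\<close>
  note skew_b = exterior_square_skew[OF r, of _ _ b]
  have "(\<Sum>j\<in>UNIV. \<Sum>m\<in>UNIV. - w $ (j, c) $ (b, m) * (B (P a) (P j) z * X m z))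
      = - con (leg12 r ** leg23 w)"
    unfolding bracket_XP nested_sum_left con_def
    by (simp add: leg_mult_component sum_negf mult_ac)
  moreover have "(\<Sum>j\<in>UNIV. \<Sum>m\<in>UNIV. - w $ (j, c) $ (b, m) * (P j z * B (P a) (X m) z))
      = con (leg23 w ** leg13 w)"
    unfolding bracket_XP nested_sum_right con_jim
    by (simp add: leg_mult_component sum_negf mult_ac)
  ultimately have 1: "B (P a) (B (P b) (X c)) z = - con (leg12 r ** leg23 w) + con (leg23 w ** leg13 w)"
    unfolding bracket_XP(3) skew_biderivation_bilinear[OF skewB smooth_coord smooth_coord smooth_coord]
    by (simp only: distrib_left sum.distrib diff_conv_add_uminus)
  have "(\<Sum>i\<in>UNIV. \<Sum>m\<in>UNIV. w $ (i, c) $ (a, m) * (B (P b) (P i) z * X m z))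
      = - con (leg12 r ** leg13 w)"
    unfolding bracket_XP nested_sum_left con_jim
    by (simp add: leg_mult_component sum_negf mult_ac skew_b)
  moreover have "(\<Sum>i\<in>UNIV. \<Sum>m\<in>UNIV. w $ (i, c) $ (a, m) * (P i z * B (P b) (X m) z))
      = - con (leg13 w ** leg23 w)"
    unfolding bracket_XP nested_sum_right con_def
    by (simp add: leg_mult_component sum_negf mult_ac skew_b)
  ultimately have 2: "B (P b) (B (X c) (P a)) z = - con (leg12 r ** leg13 w) - con (leg13 w ** leg23 w)"
    unfolding bracket_XP(4) skew_biderivation_bilinear[OF skewB smooth_coord smooth_coord smooth_coord]
    by (simp only: distrib_left sum.distrib diff_conv_add_uminus)
  have "(\<Sum>j\<in>UNIV. \<Sum>k\<in>UNIV. r $ (j, k) $ (a, b) * (B (X c) (P j) z * P k z))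
      = con (leg13 w ** leg12 r)"
    unfolding bracket_XP nested_sum_left con_imj
    by (simp add: leg_mult_component sum_negf mult_ac)
  moreover have "(\<Sum>j\<in>UNIV. \<Sum>k\<in>UNIV. r $ (j, k) $ (a, b) * (P j z * B (X c) (P k) z))
      = con (leg23 w ** leg12 r)"
    unfolding bracket_XP nested_sum_right con_def
    by (simp add: leg_mult_component sum_negf mult_ac)
  ultimately have 3: "B (X c) (B (P a) (P b)) z = con (leg13 w ** leg12 r) + con (leg23 w ** leg12 r)"
    unfolding bracket_XP(2) skew_biderivation_bilinear[OF skewB smooth_coord smooth_coord smooth_coord]
    by (simp only: distrib_left sum.distrib diff_conv_add_uminus)
  have "jacobiator B (P a) (P b) (X c) z
      = - con (commutator (leg12 r) (leg13 w + leg23 w) + commutator (leg13 w) (leg23 w))"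
    by (simp add: jacobiator_def 1 2 3 commutator_def con_diff con_add
        matrix_add_ldistrib matrix_add_rdistrib)
  then show ?thesis
    by (simp add: assms con_def)
qed

end

section \<open>Assembly over all types of coordinate triples\<close>

theorem theorem6p2:
  fixes \<g> :: "(real ^ 'n::finite ^ 'n) set"
    and r s w :: "real ^ ('n \<times> 'n) ^ ('n \<times> 'n)"
  assumes "lie_subalgebra \<g>"
    and "classical_r_matrix \<g> r"
    and "jacobi_identity (bracket vec_frame (xx_bracket r))"
    and "jacobi_identity (bracket vec_frame (pp_bracket r))"
    and "s \<in> tensor_square \<g>" and "flip s = s" and "invariant2 \<g> s"
    and "w = r + s"
    and "cyb w = 0"
  shows "jacobi_identity (bracket cotangent_frame (cotangent_bracket r w))"
proof (rule jacobi_identityI[OF frame_cotangent_frame])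
  have r: "r \<in> exterior_square \<g>"
    using assms(2) by (simp add: classical_r_matrix_def)
  then have "w \<in> tensor_square \<g>"
    using assms(5,8) exterior_square_subset[of \<g>] unfolding tensor_square_def
    by (auto intro: span_add)
  note cyb = cyb_skew_part[OF this assms(7-9)]
  show "skew_biderivation (bracket cotangent_frame (cotangent_bracket r w))"
    by (rule skew_biderivation_cotangent_bracket[OF r])
  let ?J = "\<lambda>a b c. jacobiator (bracket cotangent_frame (cotangent_bracket r w))
    (coord cotangent_frame a) (coord cotangent_frame b) (coord cotangent_frame c)"
  have cyc: "?J a b c z = 0" if "?J b c a z = 0" for a b c z
    using that by (simp only: jacobiator_cyclic[of _ _ "coord cotangent_frame b"])
  have xxx: "?J (Inl a) (Inl b) (Inl c) z = 0" for a b c z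
    by (rule jacobiator_XXX[OF r assms(3)])
  have ppp: "?J (Inr a) (Inr b) (Inr c) z = 0" for a b c z
    by (rule jacobiator_PPP[OF r assms(4)])
  have pxx: "?J (Inr a) (Inl b) (Inl c) z = 0" for a b c z
    by (rule jacobiator_PXX[OF r cyb(1)])
  have ppx: "?J (Inr a) (Inr b) (Inl c) z = 0" for a b c z
    by (rule jacobiator_PPX[OF r cyb(2)])
  \<comment> \<open>Of the eight patterns of \<open>x\<close> and \<open>p\<close> in three slots,
    the six mixed ones are the cyclic rotations of these two.\<close>
  note mixed = pxx ppx cyc[OF pxx] cyc[OF ppx] cyc[OF cyc[OF pxx]] cyc[OF cyc[OF ppx]]
  show "?J a b c z = 0" for a b c z
    by (cases a; cases b; cases c) (simp_all only: xxx ppp mixed)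
qed

end
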